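(* Let $\mathcal{C}$ be a finitary extensive category, $X$ an object of $\mathcal{C}$ and $S$ a sieve on $X$. Then $S$ is a covering sieve for the extensive topology on $\mathcal{C}$ if and only if it contains a finite family of morphisms $(f_i\colon X_i\to X)_{i\in I}$ which exhibits $X$ as a coproduct of the $X_i$.
   Context: A category is finitary extensive if it has finite coproducts, it has pullbacks along coprojections of finite coproducts, and for every commutative diagram with top row $Z_1\to Z\leftarrow Z_2$, bottom row the coprojections $X\to X\coprod Y\leftarrow Y$, and vertical maps $Z_1\to X$, $Z\to X\coprod Y$, $Z_2\to Y$, both squares are pullbacks if and only if the top row is a coproduct diagram. The extensive topology on a finitary extensive category is the smallest Grothendieck topology in which, for each finite family $(X_i\to X)_{i\in I}$ exhibiting $X$ as a coproduct of $(X_i)_{i\in I}$, the sieve generated by the family is a covering sieve. *)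

theory Defs
  imports Main
begin

section \<open>Categories\<close>

text \<open>\<open>Comp C g f\<close> is the composite in the usual order (first \<open>f\<close>, then \<open>g\<close>). Nothing is
  assumed about values outside the sets of objects and arrows, or about composites of
  non-composable arrows.\<close>

record ('o, 'm) cat =
  Obj  :: "'o set"
  Arr  :: "'m set"
  Dom  :: "'m \<Rightarrow> 'o"
  Cod  :: "'m \<Rightarrow> 'o"
  Id   :: "'o \<Rightarrow> 'm"
  Comp :: "'m \<Rightarrow> 'm \<Rightarrow> 'm"  (infixl "\<cdot>\<index>" 70)

definition hom :: "('o, 'm, 'e) cat_scheme \<Rightarrow> 'o \<Rightarrow> 'o \<Rightarrow> 'm set" where
  "hom C X Y = {f \<in> Arr C. Dom C f = X \<and> Cod C f = Y}"

locale category =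
  fixes C :: "('o, 'm, 'e) cat_scheme" (structure)
  assumes Dom_in_Obj: "f \<in> Arr C \<Longrightarrow> Dom C f \<in> Obj C"
    and Cod_in_Obj: "f \<in> Arr C \<Longrightarrow> Cod C f \<in> Obj C"
    and Id_in_hom: "X \<in> Obj C \<Longrightarrow> Id C X \<in> hom C X X"
    and Comp_in_hom: "f \<in> hom C X Y \<Longrightarrow> g \<in> hom C Y Z \<Longrightarrow> g \<cdot> f \<in> hom C X Z"
    and Comp_Id: "f \<in> hom C X Y \<Longrightarrow> f \<cdot> Id C X = f"
    and Id_Comp: "f \<in> hom C X Y \<Longrightarrow> Id C Y \<cdot> f = f"
    and Comp_assoc: "f \<in> hom C W X \<Longrightarrow> g \<in> hom C X Y \<Longrightarrow> h \<in> hom C Y Z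
      \<Longrightarrow> (h \<cdot> g) \<cdot> f = h \<cdot> (g \<cdot> f)"

section \<open>Coproducts and pullbacks\<close>

text \<open>The index set may be empty, in which case \<open>X\<close> is an initial object.\<close>

definition is_coproduct ::
  "('o, 'm, 'e) cat_scheme \<Rightarrow> 'i set \<Rightarrow> ('i \<Rightarrow> 'o) \<Rightarrow> 'o \<Rightarrow> ('i \<Rightarrow> 'm) \<Rightarrow> bool" where
  "is_coproduct C I A X f \<longleftrightarrow>
     X \<in> Obj C \<and> (\<forall>i\<in>I. f i \<in> hom C (A i) X) \<and>
     (\<forall>Y\<in>Obj C. \<forall>g. (\<forall>i\<in>I. g i \<in> hom C (A i) Y) \<longrightarrow>
        (\<exists>!h. h \<in> hom C X Y \<and> (\<forall>i\<in>I. h \<cdot>\<^bsub>C\<^esub> f i = g i)))"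

definition is_binary_coproduct ::
  "('o, 'm, 'e) cat_scheme \<Rightarrow> 'o \<Rightarrow> 'o \<Rightarrow> 'o \<Rightarrow> 'm \<Rightarrow> 'm \<Rightarrow> bool" where
  "is_binary_coproduct C X Y W i j \<longleftrightarrow>
     is_coproduct C {0, 1 :: nat} (\<lambda>k. if k = 0 then X else Y) W (\<lambda>k. if k = 0 then i else j)"

text \<open>Every finite set is in bijection with a finite set of natural numbers, so quantifying over
  finite families means quantifying over families indexed by finite sets of natural numbers.\<close>

definition has_finite_coproducts :: "('o, 'm, 'e) cat_scheme \<Rightarrow> bool" where
  "has_finite_coproducts C \<longleftrightarrow>
     (\<forall>(I :: nat set) A. finite I \<and> A ` I \<subseteq> Obj C \<longrightarrow> (\<exists>X f. is_coproduct C I A X f))"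

text \<open>The square with legs \<open>p\<close>, \<open>q\<close> over the cospan \<open>f\<close>, \<open>g\<close>, commuting as \<open>f \<cdot> p = g \<cdot> q\<close>,
  is a pullback.\<close>

definition is_pullback :: "('o, 'm, 'e) cat_scheme \<Rightarrow> 'm \<Rightarrow> 'm \<Rightarrow> 'm \<Rightarrow> 'm \<Rightarrow> bool" where
  "is_pullback C p q f g \<longleftrightarrow>
     (\<exists>P X Y Z. p \<in> hom C P X \<and> q \<in> hom C P Y \<and> f \<in> hom C X Z \<and> g \<in> hom C Y Z \<and>
        f \<cdot>\<^bsub>C\<^esub> p = g \<cdot>\<^bsub>C\<^esub> q \<and>
        (\<forall>T a b. a \<in> hom C T X \<and> b \<in> hom C T Y \<and> f \<cdot>\<^bsub>C\<^esub> a = g \<cdot>\<^bsub>C\<^esub> b \<longrightarrow>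
           (\<exists>!h. h \<in> hom C T P \<and> p \<cdot>\<^bsub>C\<^esub> h = a \<and> q \<cdot>\<^bsub>C\<^esub> h = b)))"

definition has_pullbacks_along_coprojections :: "('o, 'm, 'e) cat_scheme \<Rightarrow> bool" where
  "has_pullbacks_along_coprojections C \<longleftrightarrow>
     (\<forall>(I :: nat set) A X k i Z g. finite I \<and> is_coproduct C I A X k \<and> i \<in> I \<and> g \<in> hom C Z X \<longrightarrow>
        (\<exists>p q. is_pullback C p q g (k i)))"

section \<open>Finitary extensive categories\<close>

locale finitary_extensive_category = category C
  for C :: "('o, 'm, 'e) cat_scheme" (structure) +
  assumes finite_coproducts: "has_finite_coproducts C"
    and pullbacks_along_coprojections: "has_pullbacks_along_coprojections C"
    and extensive:
      "is_binary_coproduct C X Y W i j \<Longrightarrow>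
       z\<^sub>1 \<in> hom C Z\<^sub>1 Z \<Longrightarrow> z\<^sub>2 \<in> hom C Z\<^sub>2 Z \<Longrightarrow>
       a \<in> hom C Z\<^sub>1 X \<Longrightarrow> c \<in> hom C Z W \<Longrightarrow> b \<in> hom C Z\<^sub>2 Y \<Longrightarrow>
       c \<cdot> z\<^sub>1 = i \<cdot> a \<Longrightarrow> c \<cdot> z\<^sub>2 = j \<cdot> b \<Longrightarrow>
       is_pullback C z\<^sub>1 a c i \<and> is_pullback C z\<^sub>2 b c j \<longleftrightarrow> is_binary_coproduct C Z\<^sub>1 Z\<^sub>2 Z z\<^sub>1 z\<^sub>2"

section \<open>Sieves and Grothendieck topologies\<close>

definition sieve_on :: "('o, 'm, 'e) cat_scheme \<Rightarrow> 'o \<Rightarrow> 'm set \<Rightarrow> bool" where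
  "sieve_on C X S \<longleftrightarrow>
     S \<subseteq> {f \<in> Arr C. Cod C f = X} \<and>
     (\<forall>f\<in>S. \<forall>g\<in>Arr C. Cod C g = Dom C f \<longrightarrow> f \<cdot>\<^bsub>C\<^esub> g \<in> S)"

definition pullback_sieve :: "('o, 'm, 'e) cat_scheme \<Rightarrow> 'm \<Rightarrow> 'm set \<Rightarrow> 'm set" where
  "pullback_sieve C h S = {g \<in> Arr C. Cod C g = Dom C h \<and> h \<cdot>\<^bsub>C\<^esub> g \<in> S}"

definition generated_sieve :: "('o, 'm, 'e) cat_scheme \<Rightarrow> 'i set \<Rightarrow> ('i \<Rightarrow> 'm) \<Rightarrow> 'm set" where
  "generated_sieve C I f = {f i \<cdot>\<^bsub>C\<^esub> g | i g. i \<in> I \<and> g \<in> Arr C \<and> Cod C g = Dom C (f i)}"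

definition grothendieck_topology ::
  "('o, 'm, 'e) cat_scheme \<Rightarrow> ('o \<Rightarrow> 'm set set) \<Rightarrow> bool" where
  "grothendieck_topology C J \<longleftrightarrow>
     (\<forall>X\<in>Obj C. \<forall>S\<in>J X. sieve_on C X S) \<and>
     (\<forall>X\<in>Obj C. {f \<in> Arr C. Cod C f = X} \<in> J X) \<and>
     (\<forall>X\<in>Obj C. \<forall>S\<in>J X. \<forall>h\<in>Arr C. Cod C h = X \<longrightarrow> pullback_sieve C h S \<in> J (Dom C h)) \<and>
     (\<forall>X\<in>Obj C. \<forall>S\<in>J X. \<forall>R. sieve_on C X R \<and>
        (\<forall>h\<in>S. pullback_sieve C h R \<in> J (Dom C h)) \<longrightarrow> R \<in> J X)"

definition finite_coproduct_families_cover ::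
  "('o, 'm, 'e) cat_scheme \<Rightarrow> ('o \<Rightarrow> 'm set set) \<Rightarrow> bool" where
  "finite_coproduct_families_cover C J \<longleftrightarrow>
     (\<forall>(I :: nat set) A X f. finite I \<and> is_coproduct C I A X f \<longrightarrow> generated_sieve C I f \<in> J X)"

text \<open>The smallest topology is the intersection of all topologies with the required property; the
  lemmas below show that it is one of them and is contained in each of them.\<close>

definition extensive_topology :: "('o, 'm, 'e) cat_scheme \<Rightarrow> 'o \<Rightarrow> 'm set set" where
  "extensive_topology C X =
     \<Inter> {J X | J. grothendieck_topology C J \<and> finite_coproduct_families_cover C J}"

context category
begin

lemma discrete_topology:
  "grothendieck_topology C (\<lambda>X. {S. sieve_on C X S})"
  "finite_coproduct_families_cover C (\<lambda>X. {S. sieve_on C X S})"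
proof -
  have pb: "sieve_on C (Dom C h) (pullback_sieve C h S)"
    if S: "sieve_on C X S" and h: "h \<in> Arr C" "Cod C h = X" for X S h
    unfolding sieve_on_def
  proof (intro conjI ballI impI)
    show "pullback_sieve C h S \<subseteq> {f \<in> Arr C. Cod C f = Dom C h}"
      by (auto simp: pullback_sieve_def)
    fix f g
    assume f: "f \<in> pullback_sieve C h S" and g: "g \<in> Arr C" "Cod C g = Dom C f"
    have fg: "f \<cdot> g \<in> hom C (Dom C g) (Dom C h)"
      using f g Comp_in_hom[of g "Dom C g" "Dom C f" f "Dom C h"] by (simp add: pullback_sieve_def hom_def)
    have hf: "h \<cdot> f \<in> hom C (Dom C f) X"
      using f h Comp_in_hom[of f "Dom C f" "Dom C h" h X] by (simp add: pullback_sieve_def hom_def)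
    have "(h \<cdot> f) \<cdot> g = h \<cdot> (f \<cdot> g)"
      using f g h Comp_assoc[of g "Dom C g" "Dom C f" f "Dom C h" h X] by (simp add: pullback_sieve_def hom_def)
    moreover have "(h \<cdot> f) \<cdot> g \<in> S"
      using S f g hf by (auto simp: sieve_on_def pullback_sieve_def hom_def)
    ultimately show "f \<cdot> g \<in> pullback_sieve C h S"
      using fg by (auto simp: pullback_sieve_def hom_def)
  qed
  have "sieve_on C X {f \<in> Arr C. Cod C f = X}" for X
    unfolding sieve_on_def
  proof (intro conjI ballI impI subsetI)
    fix f g assume "f \<in> {f \<in> Arr C. Cod C f = X}" "g \<in> Arr C" "Cod C g = Dom C f"
    then show "f \<cdot> g \<in> {f \<in> Arr C. Cod C f = X}"
      using Comp_in_hom[of g "Dom C g" "Dom C f" f X] by (simp add: hom_def)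
  qed
  with pb show "grothendieck_topology C (\<lambda>X. {S. sieve_on C X S})"
    by (auto simp: grothendieck_topology_def)
  have gen: "sieve_on C X (generated_sieve C I f)" if f: "is_coproduct C I A X f"
    for I :: "nat set" and A X f
    unfolding sieve_on_def
  proof (intro conjI ballI impI subsetI)
    fix u assume "u \<in> generated_sieve C I f"
    then obtain i g where u: "u = f i \<cdot> g" "i \<in> I" "g \<in> Arr C" "Cod C g = Dom C (f i)"
      by (auto simp: generated_sieve_def)
    have "f i \<in> hom C (A i) X" using f u unfolding is_coproduct_def by (elim conjE) (rule bspec)
    then have fi: "f i \<in> hom C (Dom C (f i)) X" by (simp add: hom_def)
    have g: "g \<in> hom C (Dom C g) (Dom C (f i))" using u by (auto simp: hom_def)
    have uh: "u \<in> hom C (Dom C g) X" using Comp_in_hom[OF g fi] u by simp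
    then show "u \<in> {f \<in> Arr C. Cod C f = X}" by (auto simp: hom_def)
    fix v assume v: "v \<in> Arr C" "Cod C v = Dom C u"
    have v': "v \<in> hom C (Dom C v) (Dom C g)" using v uh by (auto simp: hom_def)
    have "u \<cdot> v = f i \<cdot> (g \<cdot> v)" using Comp_assoc[OF v' g fi] u by simp
    with Comp_in_hom[OF v' g] u show "u \<cdot> v \<in> generated_sieve C I f"
      unfolding generated_sieve_def hom_def by blast
  qed
  show "finite_coproduct_families_cover C (\<lambda>X. {S. sieve_on C X S})"
    unfolding finite_coproduct_families_cover_def mem_Collect_eq
    by (intro allI impI; elim conjE) (rule gen)
qed

lemma in_extensive_topology_iff:
  "S \<in> extensive_topology C X \<longleftrightarrow>
    (\<forall>J. grothendieck_topology C J \<longrightarrow> finite_coproduct_families_cover C J \<longrightarrow> S \<in> J X)"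
  unfolding extensive_topology_def by blast

lemma extensive_topology_least:
  assumes "grothendieck_topology C J" "finite_coproduct_families_cover C J"
  shows "extensive_topology C X \<subseteq> J X"
  using assms in_extensive_topology_iff by blast

lemma finite_coproduct_families_cover_extensive:
  "finite_coproduct_families_cover C (extensive_topology C)"
  unfolding finite_coproduct_families_cover_def[of C "extensive_topology C"] in_extensive_topology_iff
proof (intro allI impI)
  fix I :: "nat set" and A X f J
  assume I: "finite I \<and> is_coproduct C I A X f" and J: "finite_coproduct_families_cover C J"
  show "generated_sieve C I f \<in> J X"
    using J[unfolded finite_coproduct_families_cover_def, rule_format, OF I] .
qed

lemma grothendieck_topology_extensive:
  "grothendieck_topology C (extensive_topology C)"
proof -
  let ?E = "extensive_topology C"
  have 1: "sieve_on C X S" if "S \<in> ?E X" for X S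
    using extensive_topology_least[OF discrete_topology, of X] that by (simp add: subset_iff)
  have 2: "{f \<in> Arr C. Cod C f = X} \<in> ?E X" if "X \<in> Obj C" for X
    unfolding in_extensive_topology_iff
    using that by (simp add: grothendieck_topology_def)
  have 3: "pullback_sieve C h S \<in> ?E (Dom C h)"
    if X: "X \<in> Obj C" and S: "S \<in> ?E X" and h: "h \<in> Arr C" "Cod C h = X" for X S h
    unfolding in_extensive_topology_iff
  proof (intro allI impI)
    fix J assume J: "grothendieck_topology C J" "finite_coproduct_families_cover C J"
    with S have "S \<in> J X" by (simp add: in_extensive_topology_iff)
    with J(1) X h show "pullback_sieve C h S \<in> J (Dom C h)"
      by (simp add: grothendieck_topology_def)
  qed
  have 4: "R \<in> ?E X"
    if X: "X \<in> Obj C" and S: "S \<in> ?E X" and R: "sieve_on C X R"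
      and loc: "\<forall>h\<in>S. pullback_sieve C h R \<in> ?E (Dom C h)" for X S R
    unfolding in_extensive_topology_iff
  proof (intro allI impI)
    fix J assume J: "grothendieck_topology C J" "finite_coproduct_families_cover C J"
    have SJ: "S \<in> J X" and RJ: "\<forall>h\<in>S. pullback_sieve C h R \<in> J (Dom C h)"
      using S loc J by (simp_all add: in_extensive_topology_iff)
    have "\<forall>X\<in>Obj C. \<forall>S\<in>J X. \<forall>R. sieve_on C X R \<and>
        (\<forall>h\<in>S. pullback_sieve C h R \<in> J (Dom C h)) \<longrightarrow> R \<in> J X"
      using J(1) unfolding grothendieck_topology_def by (elim conjE)
    from this[rule_format, OF X SJ, of R] R RJ show "R \<in> J X" by simp
  qed
  show ?thesis
    unfolding grothendieck_topology_def[of C ?E]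
    by (intro conjI ballI allI impI; (elim conjE)?) (erule 1 2 3 4; assumption)+
qed

end

end

theory Submission
  imports Defs
begin

text \<open>
  Call a sieve \<^emph>\<open>coproduct-containing\<close> if some finite family of its members exhibits the base
  object as a coproduct (\<open>coproduct_sieves\<close>). One direction of the theorem says that every
  topology in which finite coproduct families cover contains all these sieves; this holds because
  a sieve that contains a covering sieve covers (\<open>covering_sieve_mono\<close>). For the other direction
  it suffices that the coproduct-containing sieves themselves form a Grothendieck topology, since
  the extensive topology is the smallest one.

  An identity is a coproduct family with one member, so maximal sieves are coproduct-containing.
  Transitivity holds because a coproduct of coproducts is a coproduct (\<open>is_coproduct_Sigma\<close>).
  Stability under pullback is where extensivity enters: coproduct families must be shown to be
  stable (\<open>finite_coproducts_stable\<close>). As sieves are closed under precomposition, it is enough to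
  find, for \<open>h : Z \<rightarrow> X\<close> and a finite coproduct family \<open>f\<close> on \<open>X\<close>, a coproduct family \<open>g\<close> on \<open>Z\<close>
  such that every \<open>h \<cdot> g i\<close> factors through \<open>f i\<close>. This weak form of stability goes by induction
  on the index set. The empty family is the strictness of the initial object (\<open>initial_strict\<close>),
  and adding an index means splitting \<open>X\<close> as one summand plus the coproduct of the others
  (\<open>is_coproduct_insert_split\<close>), to which the binary extensivity axiom applies.
\<close>

section \<open>Finite coproducts in a category\<close>

context category
begin

lemma homD:
  assumes "f \<in> hom C X Y"
  shows "f \<in> Arr C" "Dom C f = X" "Cod C f = Y" "X \<in> Obj C" "Y \<in> Obj C"
  using assms Dom_in_Obj Cod_in_Obj by (auto simp: hom_def)

lemma is_coproductI:
  assumes "X \<in> Obj C"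
    and "\<And>i. i \<in> I \<Longrightarrow> f i \<in> hom C (A i) X"
    and "\<And>Y g. Y \<in> Obj C \<Longrightarrow> (\<And>i. i \<in> I \<Longrightarrow> g i \<in> hom C (A i) Y)
      \<Longrightarrow> \<exists>h. h \<in> hom C X Y \<and> (\<forall>i\<in>I. h \<cdot> f i = g i)"
    and "\<And>Y h h'. h \<in> hom C X Y \<Longrightarrow> h' \<in> hom C X Y \<Longrightarrow> (\<And>i. i \<in> I \<Longrightarrow> h \<cdot> f i = h' \<cdot> f i)
      \<Longrightarrow> h = h'"
  shows "is_coproduct C I A X f"
  unfolding is_coproduct_def
proof (intro conjI ballI allI impI)
  fix Y g assume Y: "Y \<in> Obj C" and g: "\<forall>i\<in>I. g i \<in> hom C (A i) Y"
  obtain h where h: "h \<in> hom C X Y" "\<forall>i\<in>I. h \<cdot> f i = g i"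
    using assms(3)[of Y g] Y g by blast
  show "\<exists>!h. h \<in> hom C X Y \<and> (\<forall>i\<in>I. h \<cdot> f i = g i)"
  proof (rule ex1I[of _ h])
    show "h \<in> hom C X Y \<and> (\<forall>i\<in>I. h \<cdot> f i = g i)" using h by simp
    fix h' assume h': "h' \<in> hom C X Y \<and> (\<forall>i\<in>I. h' \<cdot> f i = g i)"
    show "h' = h" using assms(4)[of h' Y h] h h' by simp
  qed
qed (use assms(1,2) in auto)

lemma is_coproductD:
  assumes "is_coproduct C I A X f"
  shows "X \<in> Obj C" and "i \<in> I \<Longrightarrow> f i \<in> hom C (A i) X"
  using assms unfolding is_coproduct_def by blast+

lemma is_coproduct_copair:
  assumes "is_coproduct C I A X f" "Y \<in> Obj C" "\<And>i. i \<in> I \<Longrightarrow> g i \<in> hom C (A i) Y"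
  obtains h where "h \<in> hom C X Y" "\<And>i. i \<in> I \<Longrightarrow> h \<cdot> f i = g i"
proof -
  have "\<exists>!h. h \<in> hom C X Y \<and> (\<forall>i\<in>I. h \<cdot> f i = g i)"
    using assms unfolding is_coproduct_def by blast
  then show ?thesis using that by blast
qed

lemma is_coproduct_jointly_epi:
  assumes f: "is_coproduct C I A X f" and h: "h \<in> hom C X Y" and h': "h' \<in> hom C X Y"
    and eq: "\<And>i. i \<in> I \<Longrightarrow> h \<cdot> f i = h' \<cdot> f i"
  shows "h = h'"
proof -
  obtain k where k: "\<And>m. m \<in> hom C X Y \<Longrightarrow> (\<And>i. i \<in> I \<Longrightarrow> m \<cdot> f i = h \<cdot> f i) \<Longrightarrow> m = k"
  proof -
    have "\<forall>i\<in>I. h \<cdot> f i \<in> hom C (A i) Y"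
      using Comp_in_hom[OF is_coproductD(2)[OF f] h] by blast
    moreover have "\<forall>g. (\<forall>i\<in>I. g i \<in> hom C (A i) Y)
        \<longrightarrow> (\<exists>!k. k \<in> hom C X Y \<and> (\<forall>i\<in>I. k \<cdot> f i = g i))"
      using f homD(5)[OF h] unfolding is_coproduct_def by blast
    ultimately have "\<exists>!k. k \<in> hom C X Y \<and> (\<forall>i\<in>I. k \<cdot> f i = h \<cdot> f i)"
      by simp
    then show thesis using that by (elim ex1E) blast
  qed
  have "h = k" using k[OF h] by simp
  moreover have "h' = k" using k[OF h'] eq by simp
  ultimately show ?thesis by simp
qed

lemma is_coproduct_singleton:
  assumes "X \<in> Obj C"
  shows "is_coproduct C {i} (\<lambda>_. X) X (\<lambda>_. Id C X)"
proof (rule is_coproductI)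
  fix Y g assume "\<And>j. j \<in> {i} \<Longrightarrow> g j \<in> hom C X Y"
  then show "\<exists>h. h \<in> hom C X Y \<and> (\<forall>j\<in>{i}. h \<cdot> Id C X = g j)"
    using Comp_Id by auto
next
  fix Y h h' assume "h \<in> hom C X Y" "h' \<in> hom C X Y"
    and "\<And>j. j \<in> {i} \<Longrightarrow> h \<cdot> Id C X = h' \<cdot> Id C X"
  then show "h = h'" by (simp add: Comp_Id)
qed (use assms Id_in_hom in auto)

lemma is_coproduct_reindex:
  assumes f: "is_coproduct C K A X f" and t: "bij_betw t I K"
  shows "is_coproduct C I (A \<circ> t) X (f \<circ> t)"
proof (rule is_coproductI)
  show "X \<in> Obj C" using is_coproductD(1)[OF f] .
  have tI: "t i \<in> K" if "i \<in> I" for i using t that by (auto simp: bij_betw_def)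
  then show "(f \<circ> t) i \<in> hom C ((A \<circ> t) i) X" if "i \<in> I" for i
    using is_coproductD(2)[OF f] that by simp
  let ?s = "the_inv_into I t"
  have s: "?s k \<in> I" "t (?s k) = k" if "k \<in> K" for k
    using that t the_inv_into_into[of t I k I] f_the_inv_into_f[of t I k] by (auto simp: bij_betw_def)
  have st: "?s (t i) = i" if "i \<in> I" for i
    using that t by (auto simp: bij_betw_def the_inv_into_f_f)
  fix Y
  show "\<exists>h. h \<in> hom C X Y \<and> (\<forall>i\<in>I. h \<cdot> (f \<circ> t) i = g i)"
    if Y: "Y \<in> Obj C" and g: "\<And>i. i \<in> I \<Longrightarrow> g i \<in> hom C ((A \<circ> t) i) Y" for g
  proof -
    have "g (?s k) \<in> hom C (A k) Y" if "k \<in> K" for k using g[of "?s k"] s that by simp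
    then obtain h where "h \<in> hom C X Y" "\<And>k. k \<in> K \<Longrightarrow> h \<cdot> f k = g (?s k)"
      using is_coproduct_copair[OF f Y, of "\<lambda>k. g (?s k)"] by blast
    then show ?thesis using tI st by (intro exI[of _ h]) simp
  qed
  show "h = h'" if h: "h \<in> hom C X Y" "h' \<in> hom C X Y"
    and eq: "\<And>i. i \<in> I \<Longrightarrow> h \<cdot> (f \<circ> t) i = h' \<cdot> (f \<circ> t) i" for h h'
  proof (rule is_coproduct_jointly_epi[OF f h])
    fix k assume "k \<in> K"
    then show "h \<cdot> f k = h' \<cdot> f k" using eq[of "?s k"] s by simp
  qed
qed

text \<open>Coproducts are associative: maps out of \<open>X\<close> are families of maps out of the \<open>A i\<close>, and each of
  these is in turn a family of maps out of the \<open>B i j\<close>.\<close>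

lemma is_coproduct_Sigma:
  assumes f: "is_coproduct C I A X f"
    and g: "\<And>i. i \<in> I \<Longrightarrow> is_coproduct C (K i) (B i) (A i) (g i)"
  shows "is_coproduct C (Sigma I K) (\<lambda>(i, j). B i j) X (\<lambda>(i, j). f i \<cdot> g i j)"
proof (rule is_coproductI)
  show "X \<in> Obj C" using is_coproductD(1)[OF f] .
  have fh: "f i \<in> hom C (A i) X" if "i \<in> I" for i using is_coproductD(2)[OF f that] .
  have gh: "g i j \<in> hom C (B i j) (A i)" if "i \<in> I" "j \<in> K i" for i j
    using is_coproductD(2)[OF g] that by blast
  show "(\<lambda>(i, j). f i \<cdot> g i j) p \<in> hom C ((\<lambda>(i, j). B i j) p) X" if "p \<in> Sigma I K" for p
    using that Comp_in_hom[OF gh fh] by auto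
  fix Y
  have assoc: "(h \<cdot> f i) \<cdot> g i j = h \<cdot> (f i \<cdot> g i j)"
    if "h \<in> hom C X Y" "i \<in> I" "j \<in> K i" for h i j
    using Comp_assoc[OF gh fh] that by blast
  show "\<exists>h. h \<in> hom C X Y \<and> (\<forall>p\<in>Sigma I K. h \<cdot> (\<lambda>(i, j). f i \<cdot> g i j) p = k p)"
    if Y: "Y \<in> Obj C" and k: "\<And>p. p \<in> Sigma I K \<Longrightarrow> k p \<in> hom C ((\<lambda>(i, j). B i j) p) Y" for k
  proof -
    have "\<exists>m. m \<in> hom C (A i) Y \<and> (\<forall>j\<in>K i. m \<cdot> g i j = k (i, j))" if i: "i \<in> I" for i
    proof -
      have "k (i, j) \<in> hom C (B i j) Y" if "j \<in> K i" for j using k[of "(i, j)"] i that by simp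
      then show ?thesis using is_coproduct_copair[OF g[OF i] Y, of "\<lambda>j. k (i, j)"] by metis
    qed
    then obtain m where m: "\<And>i. i \<in> I \<Longrightarrow> m i \<in> hom C (A i) Y"
      "\<And>i j. i \<in> I \<Longrightarrow> j \<in> K i \<Longrightarrow> m i \<cdot> g i j = k (i, j)" by metis
    obtain h where h: "h \<in> hom C X Y" "\<And>i. i \<in> I \<Longrightarrow> h \<cdot> f i = m i"
      using is_coproduct_copair[OF f Y, of m] m(1) by blast
    show ?thesis using h m(2) assoc[OF h(1)] by (intro exI[of _ h]) fastforce
  qed
  show "h = h'" if h: "h \<in> hom C X Y" "h' \<in> hom C X Y"
    and eq: "\<And>p. p \<in> Sigma I K \<Longrightarrow> h \<cdot> (\<lambda>(i, j). f i \<cdot> g i j) p = h' \<cdot> (\<lambda>(i, j). f i \<cdot> g i j) p"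
    for h h'
  proof (rule is_coproduct_jointly_epi[OF f h])
    fix i assume i: "i \<in> I"
    show "h \<cdot> f i = h' \<cdot> f i"
    proof (rule is_coproduct_jointly_epi[OF g[OF i]])
      show "h \<cdot> f i \<in> hom C (A i) Y" "h' \<cdot> f i \<in> hom C (A i) Y"
        using Comp_in_hom[OF fh[OF i]] h by blast+
      fix j assume j: "j \<in> K i"
      show "(h \<cdot> f i) \<cdot> g i j = (h' \<cdot> f i) \<cdot> g i j"
        using eq[of "(i, j)"] i j assoc h by simp
    qed
  qed
qed

lemma is_binary_coproductD:
  assumes "is_binary_coproduct C X Y W a b"
  shows "a \<in> hom C X W" "b \<in> hom C Y W"
  using is_coproductD(2)[OF assms[unfolded is_binary_coproduct_def], of 0]
    is_coproductD(2)[OF assms[unfolded is_binary_coproduct_def], of 1] by simp_all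

text \<open>One further summand is a coproduct of coproducts: the outer one is binary, and the inner ones
  are a single identity and the given family.\<close>

lemma is_coproduct_insert_glue:
  assumes ab: "is_binary_coproduct C X Y W a b" and g: "is_coproduct C I B Y g" and i: "i \<notin> I"
  shows "is_coproduct C (insert i I) (B(i := X)) W ((\<lambda>j. b \<cdot> g j)(i := a))"
proof -
  let ?K = "\<lambda>k. if k = (0::nat) then {i} else I"
  let ?P = "Sigma {0, 1::nat} ?K"
  let ?B = "\<lambda>k::nat. if k = 0 then (\<lambda>_. X) else B"
  let ?g = "\<lambda>k::nat. if k = 0 then (\<lambda>_. Id C X) else g"
  let ?t = "\<lambda>j. if j = i then (0::nat, i) else (1, j)"
  note a = is_binary_coproductD(1)[OF ab]
  have "is_coproduct C (?K k) (?B k) (if k = 0 then X else Y) (?g k)" if "k \<in> {0, 1}" for k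
    using that g is_coproduct_singleton[OF homD(4)[OF a]] by auto
  from is_coproduct_Sigma[OF ab[unfolded is_binary_coproduct_def] this]
  have "is_coproduct C ?P (\<lambda>(k, j). ?B k j) W (\<lambda>(k, j). (if k = 0 then a else b) \<cdot> ?g k j)"
    by blast
  moreover have "bij_betw ?t (insert i I) ?P"
    using i by (auto simp: bij_betw_def inj_on_def image_iff)
  ultimately have "is_coproduct C (insert i I) ((\<lambda>(k, j). ?B k j) \<circ> ?t) W
      ((\<lambda>(k, j). (if k = 0 then a else b) \<cdot> ?g k j) \<circ> ?t)"
    by (rule is_coproduct_reindex)
  moreover have "(\<lambda>(k, j). ?B k j) \<circ> ?t = B(i := X)" by auto
  moreover have "(\<lambda>(k, j). (if k = 0 then a else b) \<cdot> ?g k j) \<circ> ?t = (\<lambda>j. b \<cdot> g j)(i := a)"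
    using Comp_Id[OF a] by auto
  ultimately show ?thesis by simp
qed

text \<open>This reduces finite families to the binary axiom. The complement of the summand \<open>A i\<close> is the
  comparison map \<open>u\<close> from a coproduct \<open>Y\<close> of the other summands: a map out of \<open>X\<close> with prescribed
  restriction \<open>m\<close> along \<open>u\<close> is the one whose restrictions along the \<open>f j\<close> are \<open>m \<cdot> k j\<close>.\<close>

lemma is_coproduct_insert_split:
  assumes f: "is_coproduct C (insert i I) A X f" and k: "is_coproduct C I A Y k" and i: "i \<notin> I"
  obtains u where "is_binary_coproduct C (A i) Y X (f i) u" "\<And>j. j \<in> I \<Longrightarrow> u \<cdot> k j = f j"
proof -
  have X: "X \<in> Obj C" using is_coproductD(1)[OF f] .
  have fh: "f j \<in> hom C (A j) X" if "j \<in> insert i I" for j using is_coproductD(2)[OF f that] .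
  have kh: "k j \<in> hom C (A j) Y" if "j \<in> I" for j using is_coproductD(2)[OF k that] .
  obtain u where u: "u \<in> hom C Y X" and uk: "\<And>j. j \<in> I \<Longrightarrow> u \<cdot> k j = f j"
    using is_coproduct_copair[OF k X, of f] fh by blast
  have "is_binary_coproduct C (A i) Y X (f i) u"
    unfolding is_binary_coproduct_def
  proof (rule is_coproductI)
    show "(if n = 0 then f i else u) \<in> hom C (if n = 0 then A i else Y) X" for n :: nat
      using u fh by simp
    fix T
    show "\<exists>h. h \<in> hom C X T \<and> (\<forall>n\<in>{0, 1}. h \<cdot> (if n = 0 then f i else u) = g n)"
      if T: "T \<in> Obj C" and g: "\<And>n. n \<in> {0, 1} \<Longrightarrow> g n \<in> hom C (if n = 0 then A i else Y) T"
      for g :: "nat \<Rightarrow> _"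
    proof -
      have g0: "g 0 \<in> hom C (A i) T" and g1: "g 1 \<in> hom C Y T" using g[of 0] g[of 1] by simp_all
      have "(if j = i then g 0 else g 1 \<cdot> k j) \<in> hom C (A j) T" if "j \<in> insert i I" for j
        using that g0 Comp_in_hom[OF kh g1] by auto
      from is_coproduct_copair[OF f T this] obtain h where h: "h \<in> hom C X T"
        and hf: "\<And>j. j \<in> insert i I \<Longrightarrow> h \<cdot> f j = (if j = i then g 0 else g 1 \<cdot> k j)"
        by blast
      have "h \<cdot> u = g 1"
      proof (rule is_coproduct_jointly_epi[OF k Comp_in_hom[OF u h] g1])
        fix j assume j: "j \<in> I"
        then have "(h \<cdot> u) \<cdot> k j = h \<cdot> f j" using Comp_assoc[OF kh u h] uk by simp
        then show "(h \<cdot> u) \<cdot> k j = g 1 \<cdot> k j" using hf[of j] j i by auto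
      qed
      then show ?thesis using h hf[of i] by (intro exI[of _ h]) simp
    qed
    show "h = h'" if h: "h \<in> hom C X T" and h': "h' \<in> hom C X T"
      and eq: "\<And>n. n \<in> {0, 1} \<Longrightarrow>
        h \<cdot> (if n = (0::nat) then f i else u) = h' \<cdot> (if n = 0 then f i else u)" for h h'
    proof (rule is_coproduct_jointly_epi[OF f h h'])
      fix j assume j: "j \<in> insert i I"
      show "h \<cdot> f j = h' \<cdot> f j"
      proof (cases "j = i")
        case True then show ?thesis using eq[of 0] by simp
      next
        case False
        then have j: "j \<in> I" using j by simp
        have "h \<cdot> u = h' \<cdot> u" using eq[of 1] by simp
        then show ?thesis
          using Comp_assoc[OF kh[OF j] u h] Comp_assoc[OF kh[OF j] u h'] uk[OF j] by simp
      qed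
    qed
  qed (rule X)
  then show thesis using uk that by blast
qed

lemma coproduct_family_in_generated_sieve:
  assumes "is_coproduct C I A X f" and "i \<in> I"
  shows "f i \<in> generated_sieve C I f"
proof -
  have f: "f i \<in> hom C (A i) X" using is_coproductD(2)[OF assms] .
  have "Id C (A i) \<in> hom C (A i) (A i)" using Id_in_hom[OF homD(4)[OF f]] .
  then show ?thesis
    using Comp_Id[OF f] homD[OF f] assms(2) unfolding generated_sieve_def hom_def
    by (intro CollectI exI[of _ i] exI[of _ "Id C (A i)"]) simp
qed

lemma generated_sieve_subset:
  assumes "sieve_on C X S" and "\<And>i. i \<in> I \<Longrightarrow> f i \<in> S"
  shows "generated_sieve C I f \<subseteq> S"
  using assms unfolding sieve_on_def generated_sieve_def by blast

text \<open>Enlarging a covering sieve is an instance of transitivity: along a member of the smaller sieve,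
  the larger one pulls back to a maximal sieve.\<close>

lemma covering_sieve_mono:
  assumes J: "grothendieck_topology C J" and X: "X \<in> Obj C"
    and G: "G \<in> J X" and S: "sieve_on C X S" and sub: "G \<subseteq> S"
  shows "S \<in> J X"
proof -
  have "pullback_sieve C h S \<in> J (Dom C h)" if h: "h \<in> G" for h
  proof -
    have hS: "h \<in> S" using h sub by blast
    then have "pullback_sieve C h S = {f \<in> Arr C. Cod C f = Dom C h}"
      using S unfolding sieve_on_def pullback_sieve_def by blast
    moreover have "Dom C h \<in> Obj C" using hS S Dom_in_Obj unfolding sieve_on_def by blast
    ultimately show ?thesis using J unfolding grothendieck_topology_def by simp
  qed
  moreover have "\<forall>X\<in>Obj C. \<forall>S\<in>J X. \<forall>R. sieve_on C X R \<and>
        (\<forall>h\<in>S. pullback_sieve C h R \<in> J (Dom C h)) \<longrightarrow> R \<in> J X"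
    using J unfolding grothendieck_topology_def by (elim conjE)
  ultimately show ?thesis using X G S by blast
qed

end

section \<open>Stability of finite coproducts in extensive categories\<close>

context finitary_extensive_category
begin

text \<open>As \<open>X\<close> is initial, two copies of its identity make it a coproduct \<open>X + X\<close>. By
  extensivity, pulling this back along \<open>s : Z \<rightarrow> X\<close> makes \<open>Z\<close> a coproduct \<open>Z + Z\<close> with identity
  coprojections. Hence any two morphisms \<open>Z \<rightarrow> Y\<close> are equal, and one exists through \<open>X\<close>.\<close>

lemma initial_strict:
  fixes g :: "'i \<Rightarrow> 'm" and f :: "'j \<Rightarrow> 'm"
  assumes X: "is_coproduct C {} A X f" and s: "s \<in> hom C Z X"
  shows "is_coproduct C {} B Z g"
proof -
  have XO: "X \<in> Obj C" and Z: "Z \<in> Obj C" using homD[OF s] by auto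
  have IX: "Id C X \<in> hom C X X" and IZ: "Id C Z \<in> hom C Z Z" using Id_in_hom XO Z by auto
  have X_eq: "a = b" if "a \<in> hom C X Y" "b \<in> hom C X Y" for a b Y
    using is_coproduct_jointly_epi[OF X that] by simp
  have XX: "is_binary_coproduct C X X X (Id C X) (Id C X)"
    unfolding is_binary_coproduct_def
  proof (rule is_coproductI)
    fix Y and g :: "nat \<Rightarrow> 'm"
    assume g: "\<And>i. i \<in> {0, 1} \<Longrightarrow> g i \<in> hom C (if i = 0 then X else X) Y"
    have "g 0 \<in> hom C X Y" "g 1 \<in> hom C X Y" using g[of 0] g[of 1] by simp_all
    then show "\<exists>h. h \<in> hom C X Y \<and> (\<forall>i\<in>{0, 1}. h \<cdot> (if i = 0 then Id C X else Id C X) = g i)"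
      using X_eq[of "g 0" Y "g 1"] Comp_Id by (intro exI[of _ "g 0"]) auto
  qed (use XO IX X_eq in auto)
  have pb: "is_pullback C (Id C Z) s s (Id C X)"
    unfolding is_pullback_def
  proof (rule exI[of _ Z], rule exI[of _ Z], rule exI[of _ X], rule exI[of _ X],
      intro conjI allI impI)
    show "s \<cdot> Id C Z = Id C X \<cdot> s" using Comp_Id[OF s] Id_Comp[OF s] by simp
    fix T a b assume *: "a \<in> hom C T Z \<and> b \<in> hom C T X \<and> s \<cdot> a = Id C X \<cdot> b"
    show "\<exists>!h. h \<in> hom C T Z \<and> Id C Z \<cdot> h = a \<and> s \<cdot> h = b"
      by (rule ex1I[of _ a]) (use * Id_Comp in auto)
  qed (use s IX IZ in auto)
  have ZZ: "is_coproduct C {0, 1 :: nat} (\<lambda>k. if k = 0 then Z else Z) Z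
      (\<lambda>k. if k = 0 then Id C Z else Id C Z)"
    using extensive[OF XX IZ IZ s s s] pb Comp_Id[OF s] Id_Comp[OF s]
    unfolding is_binary_coproduct_def by simp
  show ?thesis
  proof (rule is_coproductI)
    fix Y assume Y: "Y \<in> Obj C"
    obtain e where "e \<in> hom C X Y" using is_coproduct_copair[OF X Y, of undefined] by blast
    then show "\<exists>h. h \<in> hom C Z Y \<and> (\<forall>i\<in>{}. h \<cdot> g i = k i)" for k
      using Comp_in_hom[OF s] by blast
  next
    fix Y h h' assume h: "h \<in> hom C Z Y" "h' \<in> hom C Z Y"
    have "(if k = 0 then h else h') \<in> hom C (if k = 0 then Z else Z) Y" for k :: nat
      using h by simp
    from is_coproduct_copair[OF ZZ homD(5)[OF h(1)], of "\<lambda>k. if k = 0 then h else h'", OF this]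
    obtain m where m: "m \<in> hom C Z Y"
      "\<And>k :: nat. k \<in> {0, 1} \<Longrightarrow> m \<cdot> (if k = 0 then Id C Z else Id C Z) = (if k = 0 then h else h')"
      by blast
    show "h = h'" using m(2)[of 0] m(2)[of 1] by simp
  qed (use Z in auto)
qed

lemma pullback_of_coproduct:
  assumes X: "is_binary_coproduct C X Y W i j" and h: "h \<in> hom C Z W"
  obtains Z1 Z2 z1 z2 a b where "is_binary_coproduct C Z1 Z2 Z z1 z2"
    "a \<in> hom C Z1 X" "b \<in> hom C Z2 Y" "h \<cdot> z1 = i \<cdot> a" "h \<cdot> z2 = j \<cdot> b"
proof -
  have i: "i \<in> hom C X W" and j: "j \<in> hom C Y W" using is_binary_coproductD[OF X] .
  have pb: "\<exists>p q. is_pullback C p q h (if n = 0 then i else j)" if "n \<in> {0, 1}" for n :: nat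
    using pullbacks_along_coprojections[unfolded has_pullbacks_along_coprojections_def, rule_format,
        of "{0, 1}" _ W "\<lambda>k. if k = 0 then i else j" n h Z]
      X[unfolded is_binary_coproduct_def] h that by blast
  obtain z1 a z2 b where pb1: "is_pullback C z1 a h i" and pb2: "is_pullback C z2 b h j"
    using pb[of 0] pb[of 1] by auto
  obtain Z1 where 1: "z1 \<in> hom C Z1 Z" "a \<in> hom C Z1 X" "h \<cdot> z1 = i \<cdot> a"
    using pb1 homD[OF h] homD[OF i] unfolding is_pullback_def by (fastforce simp: hom_def)
  obtain Z2 where 2: "z2 \<in> hom C Z2 Z" "b \<in> hom C Z2 Y" "h \<cdot> z2 = j \<cdot> b"
    using pb2 homD[OF h] homD[OF j] unfolding is_pullback_def by (fastforce simp: hom_def)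
  have "is_binary_coproduct C Z1 Z2 Z z1 z2"
    using extensive[OF X 1(1) 2(1) 1(2) h 2(2) 1(3) 2(3)] pb1 pb2 by blast
  then show thesis using that 1 2 by blast
qed

text \<open>The \<open>g i\<close> are in fact pullbacks of the \<open>f i\<close>, but only their factorisation through
  the \<open>f i\<close> matters for sieves, and it spares pasting pullback squares in the induction.\<close>

lemma finite_coproducts_stable:
  fixes I :: "nat set"
  assumes "finite I" and "is_coproduct C I A X f" and "h \<in> hom C Z X"
  shows "\<exists>B g s. is_coproduct C I B Z g \<and> (\<forall>i\<in>I. s i \<in> hom C (B i) (A i) \<and> h \<cdot> g i = f i \<cdot> s i)"
  using assms
proof (induction I arbitrary: X f Z h rule: finite_induct)
  case empty
  then show ?case using initial_strict by blast
next
  case (insert i I)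
  have "A ` I \<subseteq> Obj C"
    using is_coproductD(2)[OF insert.prems(1)] homD(4) by blast
  then obtain Y k where k: "is_coproduct C I A Y k"
    using finite_coproducts insert.hyps(1) unfolding has_finite_coproducts_def by blast
  obtain u where u: "is_binary_coproduct C (A i) Y X (f i) u"
    and uk: "\<And>j. j \<in> I \<Longrightarrow> u \<cdot> k j = f j"
    using is_coproduct_insert_split[OF insert.prems(1) k insert.hyps(2)] by blast
  obtain Z1 Z2 z1 z2 a b where Z: "is_binary_coproduct C Z1 Z2 Z z1 z2"
    and a: "a \<in> hom C Z1 (A i)" and b: "b \<in> hom C Z2 Y"
    and ha: "h \<cdot> z1 = f i \<cdot> a" and hb: "h \<cdot> z2 = u \<cdot> b"
    using pullback_of_coproduct[OF u insert.prems(2)] by blast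
  obtain B g s where g: "is_coproduct C I B Z2 g"
    and s: "\<And>j. j \<in> I \<Longrightarrow> s j \<in> hom C (B j) (A j)"
    and bg: "\<And>j. j \<in> I \<Longrightarrow> b \<cdot> g j = k j \<cdot> s j"
    using insert.IH[OF k b] by blast
  let ?B = "B(i := Z1)" and ?g = "(\<lambda>j. z2 \<cdot> g j)(i := z1)" and ?s = "s(i := a)"
  have "is_coproduct C (insert i I) ?B Z ?g"
    by (rule is_coproduct_insert_glue[OF Z g insert.hyps(2)])
  moreover have "?s j \<in> hom C (?B j) (A j) \<and> h \<cdot> ?g j = f j \<cdot> ?s j" if j: "j \<in> insert i I" for j
  proof (cases "j = i")
    case True then show ?thesis using a ha by simp
  next
    case False
    then have jI: "j \<in> I" using j by simp
    note gj = is_coproductD(2)[OF g jI] and kj = is_coproductD(2)[OF k jI]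
    note z2 = is_binary_coproductD(2)[OF Z] and uh = is_binary_coproductD(2)[OF u]
    have "h \<cdot> (z2 \<cdot> g j) = (u \<cdot> b) \<cdot> g j"
      using Comp_assoc[OF gj z2 insert.prems(2)] hb by simp
    also have "\<dots> = u \<cdot> (k j \<cdot> s j)" using Comp_assoc[OF gj b uh] bg[OF jI] by simp
    also have "\<dots> = f j \<cdot> s j" using Comp_assoc[OF s[OF jI] kj uh] uk[OF jI] by simp
    finally show ?thesis using False s[OF jI] by simp
  qed
  ultimately show ?case by blast
qed

section \<open>The topology of sieves containing a finite coproduct family\<close>

definition coproduct_sieves :: "'o \<Rightarrow> 'm set set" where
  "coproduct_sieves X = {S. sieve_on C X S \<and>
     (\<exists>(I :: nat set) A f. finite I \<and> is_coproduct C I A X f \<and> (\<forall>i\<in>I. f i \<in> S))}"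

lemma coproduct_sieves_pullback:
  assumes S: "S \<in> coproduct_sieves X" and h: "h \<in> hom C Z X"
  shows "pullback_sieve C h S \<in> coproduct_sieves Z"
proof -
  obtain I :: "nat set" and A f where I: "finite I" "is_coproduct C I A X f" "\<forall>i\<in>I. f i \<in> S"
    and sS: "sieve_on C X S"
    using S unfolding coproduct_sieves_def by blast
  obtain B g s where g: "is_coproduct C I B Z g"
    and s: "\<And>i. i \<in> I \<Longrightarrow> s i \<in> hom C (B i) (A i)" "\<And>i. i \<in> I \<Longrightarrow> h \<cdot> g i = f i \<cdot> s i"
    using finite_coproducts_stable[OF I(1,2) h] by blast
  have "g i \<in> pullback_sieve C h S" if i: "i \<in> I" for i
  proof -
    have "f i \<cdot> s i \<in> S"
      using sS I(3) i homD[OF s(1)[OF i]] homD(2)[OF is_coproductD(2)[OF I(2) i]]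
      unfolding sieve_on_def by simp
    then show ?thesis
      using s(2)[OF i] homD[OF is_coproductD(2)[OF g i]] homD[OF h]
      unfolding pullback_sieve_def by simp
  qed
  moreover have "sieve_on C Z (pullback_sieve C h S)"
    using discrete_topology(1) sS homD[OF h] unfolding grothendieck_topology_def by blast
  ultimately show ?thesis using I(1) g unfolding coproduct_sieves_def by blast
qed

text \<open>The local condition is applied to the members of a coproduct family in \<open>S\<close>. The coproduct
  families that it yields on their domains compose with them to one family on \<open>X\<close> indexed by pairs,
  which is then renumbered.\<close>

lemma coproduct_sieves_transitive:
  assumes S: "S \<in> coproduct_sieves X" and R: "sieve_on C X R"
    and loc: "\<And>h. h \<in> S \<Longrightarrow> pullback_sieve C h R \<in> coproduct_sieves (Dom C h)"
  shows "R \<in> coproduct_sieves X"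
proof -
  obtain I :: "nat set" and A f where I: "finite I" "is_coproduct C I A X f" "\<forall>i\<in>I. f i \<in> S"
    using S unfolding coproduct_sieves_def by blast
  have "\<exists>(K :: nat set) B g. finite K \<and> is_coproduct C K B (A i) g \<and> (\<forall>j\<in>K. f i \<cdot> g j \<in> R)"
    if i: "i \<in> I" for i
  proof -
    have "Dom C (f i) = A i" using homD(2)[OF is_coproductD(2)[OF I(2) i]] .
    then have "pullback_sieve C (f i) R \<in> coproduct_sieves (A i)" using loc[of "f i"] I(3) i by simp
    then show ?thesis unfolding coproduct_sieves_def pullback_sieve_def by blast
  qed
  then obtain K :: "nat \<Rightarrow> nat set" and B g where K: "\<And>i. i \<in> I \<Longrightarrow> finite (K i)"
    "\<And>i. i \<in> I \<Longrightarrow> is_coproduct C (K i) (B i) (A i) (g i)"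
    "\<And>i j. i \<in> I \<Longrightarrow> j \<in> K i \<Longrightarrow> f i \<cdot> g i j \<in> R"
    by metis
  have fin: "finite (Sigma I K)" using I(1) K(1) by blast
  obtain t where t: "bij_betw t {0..<card (Sigma I K)} (Sigma I K)"
    using ex_bij_betw_nat_finite[OF fin] by blast
  let ?B = "(\<lambda>(i, j). B i j) \<circ> t" and ?g = "(\<lambda>(i, j). f i \<cdot> g i j) \<circ> t"
  have "is_coproduct C {0..<card (Sigma I K)} ?B X ?g"
    by (rule is_coproduct_reindex[OF is_coproduct_Sigma[OF I(2) K(2)] t])
  moreover have "?g n \<in> R" if "n \<in> {0..<card (Sigma I K)}" for n
    using bij_betwE[OF t] that K(3) by fastforce
  ultimately show ?thesis using R unfolding coproduct_sieves_def by blast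
qed

lemma grothendieck_topology_coproduct_sieves:
  "grothendieck_topology C coproduct_sieves"
proof -
  have "{f \<in> Arr C. Cod C f = X} \<in> coproduct_sieves X" if X: "X \<in> Obj C" for X
  proof -
    have "sieve_on C X {f \<in> Arr C. Cod C f = X}"
      using discrete_topology(1) X unfolding grothendieck_topology_def by blast
    then show ?thesis
      using is_coproduct_singleton[OF X, of 0] homD[OF Id_in_hom[OF X]]
      unfolding coproduct_sieves_def by blast
  qed
  then show ?thesis
    unfolding grothendieck_topology_def
    using coproduct_sieves_pullback coproduct_sieves_transitive
    by (auto simp: hom_def) (auto simp: coproduct_sieves_def)
qed

lemma finite_coproduct_families_cover_coproduct_sieves:
  "finite_coproduct_families_cover C coproduct_sieves"
proof -
  have "generated_sieve C I f \<in> coproduct_sieves X"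
    if "finite I" "is_coproduct C I A X f" for I :: "nat set" and A X f
  proof -
    have "sieve_on C X (generated_sieve C I f)"
      using discrete_topology(2) that unfolding finite_coproduct_families_cover_def by blast
    then show ?thesis
      using that coproduct_family_in_generated_sieve[OF that(2)]
      unfolding coproduct_sieves_def by blast
  qed
  then show ?thesis unfolding finite_coproduct_families_cover_def by blast
qed

end

theorem proposition6p7:
  fixes C :: "('o, 'm, 'e) cat_scheme" and X :: 'o and S :: "'m set"
  assumes "finitary_extensive_category C"
    and "X \<in> Obj C"
    and "sieve_on C X S"
  shows "S \<in> extensive_topology C X \<longleftrightarrow>
    (\<exists>(I :: nat set) A f. finite I \<and> is_coproduct C I A X f \<and> (\<forall>i\<in>I. f i \<in> S))"
proof -
  interpret finitary_extensive_category C by (rule assms(1))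
  show ?thesis
  proof
    assume "S \<in> extensive_topology C X"
    then have "S \<in> coproduct_sieves X"
      using extensive_topology_least[OF grothendieck_topology_coproduct_sieves
          finite_coproduct_families_cover_coproduct_sieves] by blast
    then show "\<exists>(I :: nat set) A f. finite I \<and> is_coproduct C I A X f \<and> (\<forall>i\<in>I. f i \<in> S)"
      unfolding coproduct_sieves_def by blast
  next
    assume "\<exists>(I :: nat set) A f. finite I \<and> is_coproduct C I A X f \<and> (\<forall>i\<in>I. f i \<in> S)"
    then obtain I :: "nat set" and A f
      where I: "finite I" "is_coproduct C I A X f" "\<And>i. i \<in> I \<Longrightarrow> f i \<in> S" by blast
    have "generated_sieve C I f \<in> extensive_topology C X"
      using finite_coproduct_families_cover_extensive I(1,2)
      unfolding finite_coproduct_families_cover_def by blast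
    then show "S \<in> extensive_topology C X"
      by (rule covering_sieve_mono[OF grothendieck_topology_extensive assms(2) _ assms(3)])
        (rule generated_sieve_subset[OF assms(3) I(3)])
  qed
qed

end
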